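(* Let $L$ be the length of the longest run of consecutive equal parts in a uniformly random integer composition of size $n$. Then, as $n\to\infty$, $$\mathbb{P}_n(L<k)=e^{-n/2^{k+2}}\left(1+O\left(\frac{\log n}{\sqrt n}\right)\right),$$ uniformly for $k\in\mathbb{Z}$ such that $\frac34\lg n\le k\le 2\lg n$ (the implied constant does not depend on $k$ or $n$). Equivalently, $$\mathbb{P}_n(L<\lfloor\lg n\rfloor+h)=e^{-\omega(n)2^{-h-2}}\left(1+O\left(\frac{\log n}{\sqrt n}\right)\right),\qquad \omega(n)=2^{\{\lg n\}},$$ uniformly for $h\in\mathbb{Z}$ such that $-\frac14\lg n+\{\lg n\}\le h\le \lg n+\{\lg n\}$.
   Context: A composition of size $n$ is a finite sequence $(x_1,\dots,x_m)$ of positive integers (the parts) with $x_1+\cdots+x_m=n$. $\mathbb{P}_n$ is the uniform probability on the set of all compositions of size $n$ (of which there are $2^{n-1}$ for $n\ge1$). $L$ is the random variable giving the maximal length of a block of consecutive equal parts, e.g. $L=5$ for $3,2,1,4,4,4,4,4,7,3,5,5,4,2$. Notation: $\lg n=\log_2 n$, $\log$ is the natural logarithm, and $\{\alpha\}=\alpha-\lfloor\alpha\rfloor$ is the fractional part of $\alpha$. *)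

theory Defs
  imports "HOL-Probability.Probability" "HOL-Library.Sublist"
begin

definition compositions :: "nat \<Rightarrow> nat list set" where
  "compositions n = {xs. (\<forall>x\<in>set xs. 0 < x) \<and> sum_list xs = n}"

lemma length_composition_le:
  assumes "xs \<in> compositions n"
  shows "length xs \<le> n"
proof -
  have "\<forall>x\<in>set xs. 0 < x \<Longrightarrow> length xs \<le> sum_list xs" for xs :: "nat list"
    by (induction xs) auto
  then show ?thesis
    using assms by (auto simp: compositions_def)
qed

lemma finite_compositions: "finite (compositions n)"
proof (rule finite_subset)
  show "compositions n \<subseteq> {xs. set xs \<subseteq> {..n} \<and> length xs \<le> n}"
    using length_composition_le by (auto simp: compositions_def intro: member_le_sum_list)
  show "finite {xs. set xs \<subseteq> {..n} \<and> length xs \<le> n}"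
    by (rule finite_lists_length_le) simp
qed

lemma compositions_nonempty: "compositions n \<noteq> {}"
proof -
  have "replicate n 1 \<in> compositions n"
    by (auto simp: compositions_def sum_list_replicate)
  then show ?thesis by blast
qed

definition random_composition :: "nat \<Rightarrow> nat list pmf" where
  "random_composition n = pmf_of_set (compositions n)"

text \<open>The library's \<^const>\<open>sublist\<close> is the contiguous-block relation. The set below always
  contains 0, so the longest run of the empty list is 0.\<close>

definition longest_run :: "'a list \<Rightarrow> nat" where
  "longest_run xs = Max {m. \<exists>a. sublist (replicate m a) xs}"

lemma finite_run_lengths: "finite {m. \<exists>a. sublist (replicate m a) xs}"
  by (rule finite_subset[of _ "{..length xs}"]) (auto dest: sublist_length_le)

definition omega :: "nat \<Rightarrow> real" where
  "omega n = 2 powr frac (log 2 (real n))"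

end

theory Submission
  imports Defs
begin

text \<open>
  Let \<open>a(N)\<close> be the number of compositions of \<open>N\<close> in which no \<open>k\<close> consecutive parts are equal.
  The theorem is an estimate of \<open>a(n) / 2 ^ (n - 1)\<close>, and it follows from a linear recurrence for
  \<open>a\<close> whose solutions decay almost exactly geometrically.

  Let \<open>b\<^sub>j(N)\<close> count the ways in which prefixing a part \<open>j\<close> to an admissible
  composition gives a composition of \<open>N\<close> that is no longer admissible. Classifying by the first part,
  \<open>a(N) = (\<Sum>m<N. a(m)) - (\<Sum>j. b\<^sub>j(N))\<close>. An admissible composition that is spoilt
  by prefixing \<open>j\<close> begins with exactly \<open>k - 1\<close> copies of \<open>j\<close>, and what follows is an admissible composition of \<open>N - k j\<close> that does not
  begin with \<open>j\<close>; therefore \<open>b\<^sub>j(N) = a(N - k j) - a(N - (k + 1) j) + b\<^sub>j(N - k j)\<close>. Since \<open>a\<close>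
  grows roughly like \<open>2 ^ N\<close>, only \<open>j = 1\<close> matters to first order. With \<open>\<epsilon> = 1 / 2 ^ k\<close> and
  \<open>p(N) = a(N) / 2 ^ N\<close> this becomes (\<open>scaled_step\<close>)
  \<open>p(N) = p(N - 1) - \<epsilon> (p(N - k) - p(N - k - 1) + p(N - k - 2) / 4) + O(\<epsilon>\<^sup>2 p(N - 2 k))\<close>.

  By induction consecutive values of \<open>p\<close> from \<open>N = 1\<close> on differ by a factor \<open>1 + O(\<epsilon>)\<close>
  (\<open>scaled_ratio_crude\<close>), so values of \<open>p\<close> at distance \<open>O(k)\<close> differ by a factor \<open>1 + O(k \<epsilon>)\<close>.
  Feeding this back, the bracket is \<open>p(N - 1) / 4\<close> up to a relative error \<open>O(k \<epsilon>)\<close>, hence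
  \<open>p(N) = (1 - \<epsilon> / 4 + O(k \<epsilon>\<^sup>2)) p(N - 1)\<close> as soon as \<open>N \<ge> k + 3\<close> (\<open>scaled_ratio_fine\<close>).
  Adding up logarithms gives \<open>ln (2 p(n)) = - n \<epsilon> / 4 + O(k \<epsilon> + n k \<epsilon>\<^sup>2)\<close> (\<open>ln_scaled_approx\<close>).

  The main term \<open>n \<epsilon> / 4\<close> is \<open>n / 2 ^ (k + 2)\<close>. If \<open>3/4 log\<^sub>2 n \<le> k \<le> 2 log\<^sub>2 n\<close>,
  then \<open>\<epsilon> \<le> n powr (- 3/4)\<close> and both error terms are \<open>O(k / sqrt n) = O(ln n / sqrt n)\<close>. The lower
  bound on \<open>k\<close> is where \<open>n k \<epsilon>\<^sup>2\<close> reaches this size. Because the error is controlled inside the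
  logarithm, it is relative even where the probability itself is tiny. The version with
  \<open>\<lfloor>log\<^sub>2 n\<rfloor> + h\<close> is the change of variable \<open>omega_rescaling\<close>.
\<close>

section \<open>Counting compositions without long runs\<close>

definition run_free :: "nat \<Rightarrow> 'a list \<Rightarrow> bool" where
  "run_free k xs \<longleftrightarrow> (\<forall>a. \<not> sublist (replicate k a) xs)"

text \<open>Run lengths are closed downwards, so missing the length \<open>k\<close> means missing all larger ones.\<close>
lemma longest_run_less_iff_run_free:
  "longest_run xs < k \<longleftrightarrow> run_free k xs"
proof -
  let ?S = "{m. \<exists>a. sublist (replicate m a) xs}"
  have "0 \<in> ?S" by simp
  then have ne: "?S \<noteq> {}" by blast
  have "longest_run xs < k \<longleftrightarrow> (\<forall>m\<in>?S. m < k)"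
    unfolding longest_run_def using finite_run_lengths ne by (rule Max_less_iff)
  also have "\<dots> \<longleftrightarrow> run_free k xs"
  proof
    show "\<forall>m\<in>?S. m < k \<Longrightarrow> run_free k xs"
      by (auto simp: run_free_def)
    assume rf: "run_free k xs"
    show "\<forall>m\<in>?S. m < k"
    proof (rule ballI, rule ccontr)
      fix m assume "m \<in> ?S" and "\<not> m < k"
      then obtain a where a: "sublist (replicate m a) xs" and "k \<le> m" by auto
      then have "replicate m a = replicate k a @ replicate (m - k) a"
        by (simp flip: replicate_add)
      then have "sublist (replicate k a) (replicate m a)" by simp
      then have "sublist (replicate k a) xs" using a by (rule sublist_order.order_trans)
      with rf show False by (simp add: run_free_def)
    qed
  qed
  finally show ?thesis .
qed

lemma run_free_Nil: "0 < k \<Longrightarrow> run_free k []"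
  by (simp add: run_free_def)

lemma run_free_Cons:
  assumes "0 < k"
  shows "run_free k (j # w) \<longleftrightarrow> run_free k w \<and> \<not> prefix (replicate (k - 1) j) w"
proof -
  obtain l where k: "k = Suc l" using assms by (cases k) auto
  show ?thesis by (auto simp: run_free_def k sublist_Cons_right)
qed

lemma run_free_appendD: "run_free k (xs @ ys) \<Longrightarrow> run_free k ys"
  by (simp add: run_free_def sublist_append)

lemma run_free_short: "length xs < k \<Longrightarrow> run_free k xs"
  unfolding run_free_def by (auto dest!: sublist_length_le)

text \<open>If \<open>u\<close> does not begin with \<open>j\<close>, the initial run of \<open>replicate i j @ u\<close> has length exactly \<open>i\<close>.
  This is why a short run may be put in front of \<open>u\<close> without creating a long one.\<close>
lemma prefix_replicate_longer:
  assumes "i < l" "prefix (replicate l j) (replicate i j @ u)"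
  shows "prefix [j] u"
proof -
  obtain d where d: "l = i + Suc d" using assms(1) less_imp_Suc_add by auto
  have "prefix (replicate i j @ j # replicate d j) (replicate i j @ u)"
    using assms(2) unfolding d replicate_add by simp
  then have "prefix (j # replicate d j) u" by simp
  then show ?thesis by (cases u) auto
qed

lemma run_free_replicate_append:
  assumes "run_free k u" "\<not> prefix [j] u" "i < k"
  shows "run_free k (replicate i j @ u)"
  using assms(3)
proof (induction i)
  case (Suc i)
  then have "\<not> prefix (replicate (k - 1) j) (replicate i j @ u)"
    using prefix_replicate_longer[of i "k - 1" j u] assms(2) Suc.prems by linarith
  moreover have "run_free k (replicate i j @ u)" using Suc by simp
  ultimately show ?case using Suc.prems by (simp add: run_free_Cons)
qed (use assms in simp)

text \<open>The size is an integer, so that the recurrences below hold verbatim near \<open>0\<close>: there are no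
  compositions of negative size.\<close>
definition run_free_comps :: "nat \<Rightarrow> int \<Rightarrow> nat list set" where
  "run_free_comps k N = {xs. (\<forall>x\<in>set xs. 0 < x) \<and> int (sum_list xs) = N \<and> run_free k xs}"

text \<open>Here \<open>N\<close> is the size of \<open>j # w\<close>, the composition that gets rejected, not of \<open>w\<close>.\<close>
definition blocked_comps :: "nat \<Rightarrow> nat \<Rightarrow> int \<Rightarrow> nat list set" where
  "blocked_comps k j N = {w \<in> run_free_comps k (N - int j). \<not> run_free k (j # w)}"

definition num_run_free :: "nat \<Rightarrow> int \<Rightarrow> real" where
  "num_run_free k N = real (card (run_free_comps k N))"

definition num_blocked :: "nat \<Rightarrow> nat \<Rightarrow> int \<Rightarrow> real" where
  "num_blocked k j N = real (card (blocked_comps k j N))"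

lemma run_free_comps_eq_compositions:
  "run_free_comps k (int n) = {xs \<in> compositions n. run_free k xs}"
  by (auto simp: run_free_comps_def compositions_def)

lemma finite_run_free_comps: "finite (run_free_comps k N)"
proof (cases "0 \<le> N")
  case True
  then obtain n where "N = int n" by (metis nonneg_int_cases)
  then show ?thesis using finite_compositions[of n] by (simp add: run_free_comps_eq_compositions)
next
  case False
  then have "run_free_comps k N = {}" by (auto simp: run_free_comps_def)
  then show ?thesis by simp
qed

lemma num_run_free_nonneg: "0 \<le> num_run_free k N"
  by (simp add: num_run_free_def)

lemma num_run_free_neg: "N < 0 \<Longrightarrow> num_run_free k N = 0"
  by (auto simp: num_run_free_def run_free_comps_def)

lemma num_run_free_0: assumes "0 < k" shows "num_run_free k 0 = 1"
proof -
  have "run_free_comps k 0 = {[]}"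
    using run_free_Nil[OF assms] by (auto simp: run_free_comps_def) (metis gr0_conv_Suc list.set_intros(1) neq_Nil_conv not_gr0)
  then show ?thesis by (simp add: num_run_free_def)
qed

lemma num_blocked_nonneg: "0 \<le> num_blocked k j N"
  by (simp add: num_blocked_def)

lemma card_comps_starting_with:
  assumes "0 < k" "0 < j"
  shows "real (card {xs \<in> run_free_comps k N. prefix [j] xs}) = num_run_free k (N - int j) - num_blocked k j N"
proof -
  let ?T = "run_free_comps k (N - int j) - blocked_comps k j N"
  have "{xs \<in> run_free_comps k N. prefix [j] xs} = (#) j ` ?T" (is "?L = ?R")
  proof
    show "?L \<subseteq> ?R"
    proof
      fix xs assume xs: "xs \<in> ?L"
      then obtain w where w: "xs = j # w" by (cases xs) auto
      with xs have "w \<in> ?T"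
        using assms by (auto simp: run_free_comps_def blocked_comps_def run_free_Cons)
      with w show "xs \<in> ?R" by blast
    qed
    show "?R \<subseteq> ?L"
      using assms by (auto simp: run_free_comps_def blocked_comps_def)
  qed
  then have "card ?L = card ?T" by (simp add: card_image)
  also have "\<dots> = card (run_free_comps k (N - int j)) - card (blocked_comps k j N)"
    by (rule card_Diff_subset) (auto simp: blocked_comps_def finite_run_free_comps)
  finally show ?thesis
    using card_mono[of "run_free_comps k (N - int j)" "blocked_comps k j N"]
    by (auto simp: num_run_free_def num_blocked_def finite_run_free_comps blocked_comps_def of_nat_diff)
qed

text \<open>Removing the first part \<open>j\<close> leaves an admissible composition of \<open>N - j\<close>, and every such
  composition arises except the blocked ones.\<close>
lemma num_run_free_first_part:
  assumes "0 < k" "1 \<le> N"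
  shows "num_run_free k N = (\<Sum>m\<in>{0..<N}. num_run_free k m) - (\<Sum>j\<in>{1..nat N}. num_blocked k j N)"
proof -
  have U: "run_free_comps k N = (\<Union>j\<in>{1..nat N}. {xs \<in> run_free_comps k N. prefix [j] xs})"
  proof (intro subset_antisym subsetI)
    fix xs assume xs: "xs \<in> run_free_comps k N"
    with assms obtain j w where jw: "xs = j # w" by (cases xs) (auto simp: run_free_comps_def)
    with xs have "j \<in> {1..nat N}" by (auto simp: run_free_comps_def)
    with xs jw show "xs \<in> (\<Union>j\<in>{1..nat N}. {xs \<in> run_free_comps k N. prefix [j] xs})" by auto
  qed auto
  have "card (run_free_comps k N) = (\<Sum>j\<in>{1..nat N}. card {xs \<in> run_free_comps k N. prefix [j] xs})"
    by (subst U, rule card_UN_disjoint) (auto simp: finite_run_free_comps prefix_def)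
  then have "num_run_free k N = (\<Sum>j\<in>{1..nat N}. real (card {xs \<in> run_free_comps k N. prefix [j] xs}))"
    by (simp add: num_run_free_def)
  also have "\<dots> = (\<Sum>j\<in>{1..nat N}. num_run_free k (N - int j) - num_blocked k j N)"
    using assms by (intro sum.cong refl card_comps_starting_with) auto
  also have "\<dots> = (\<Sum>j\<in>{1..nat N}. num_run_free k (N - int j)) - (\<Sum>j\<in>{1..nat N}. num_blocked k j N)"
    by (simp add: sum_subtractf)
  also have "(\<Sum>j\<in>{1..nat N}. num_run_free k (N - int j)) = (\<Sum>m\<in>{0..<N}. num_run_free k m)"
    using assms(2)
    by (intro sum.reindex_bij_witness[of _ "\<lambda>m. nat (N - m)" "\<lambda>j. N - int j"]) auto
  finally show ?thesis .
qed

text \<open>Prefixing \<open>j\<close> to an admissible \<open>w\<close> completes a run of length \<open>k\<close> exactly when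
  \<open>w = replicate (k - 1) j @ u\<close>; admissibility of \<open>w\<close> then says that \<open>u\<close> is admissible and does not
  begin with \<open>j\<close>. The last two terms subtract the admissible compositions that do begin with \<open>j\<close>.\<close>
lemma num_blocked_rec:
  assumes "0 < k" "0 < j"
  shows "num_blocked k j N = num_run_free k (N - int (k * j)) - num_run_free k (N - int (k * j) - int j)
           + num_blocked k j (N - int (k * j))"
proof -
  let ?M = "N - int (k * j)"
  let ?T = "run_free_comps k ?M - {xs \<in> run_free_comps k ?M. prefix [j] xs}"
  have rep: "replicate k j = j # replicate (k - 1) j" for j :: nat
    using assms(1) by (cases k) auto
  have kj: "int (k * j) = int j + int ((k - 1) * j)"
    using assms(1) by (cases k) auto
  have "blocked_comps k j N = (@) (replicate (k - 1) j) ` ?T" (is "?L = ?R")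
  proof
    show "?L \<subseteq> ?R"
    proof
      fix w assume w: "w \<in> ?L"
      then obtain u where u: "w = replicate (k - 1) j @ u"
        using assms by (auto simp: blocked_comps_def run_free_comps_def run_free_Cons prefix_def)
      have rf: "run_free k w" using w by (auto simp: blocked_comps_def run_free_comps_def)
      have "\<not> prefix [j] u"
      proof
        assume "prefix [j] u"
        then obtain v where "u = j # v" by (auto simp: prefix_def)
        then have "w = replicate k j @ v"
          using u rep[of j] by (simp add: replicate_app_Cons_same)
        then have "sublist (replicate k j) w" by simp
        with rf show False by (simp add: run_free_def)
      qed
      moreover have "run_free k u" using rf run_free_appendD u by blast
      ultimately have "u \<in> ?T"
        using w u kj by (auto simp: blocked_comps_def run_free_comps_def sum_list_replicate)
      with u show "w \<in> ?R" by blast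
    qed
    show "?R \<subseteq> ?L"
    proof
      fix w assume "w \<in> ?R"
      then obtain u where u: "u \<in> ?T" "w = replicate (k - 1) j @ u" by blast
      then have "run_free k w"
        using run_free_replicate_append[of k u j "k - 1"] assms by (auto simp: run_free_comps_def)
      with u assms kj show "w \<in> ?L"
        by (auto simp: blocked_comps_def run_free_comps_def run_free_Cons sum_list_replicate)
    qed
  qed
  moreover have "inj_on ((@) (replicate (k - 1) j)) ?T" by (rule inj_onI) simp
  ultimately have "card ?L = card ?T" by (simp only: card_image)
  also have "\<dots> = card (run_free_comps k ?M) - card {xs \<in> run_free_comps k ?M. prefix [j] xs}"
    by (rule card_Diff_subset) (auto simp: finite_run_free_comps)
  also have "real \<dots> = num_run_free k ?M - real (card {xs \<in> run_free_comps k ?M. prefix [j] xs})"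
    using card_mono[of "run_free_comps k ?M" "{xs \<in> run_free_comps k ?M. prefix [j] xs}"]
    by (auto simp: num_run_free_def finite_run_free_comps of_nat_diff)
  finally show ?thesis
    using card_comps_starting_with[OF assms, of ?M] by (simp add: num_blocked_def)
qed

lemma num_blocked_le:
  assumes "0 < k" "0 < j"
  shows "num_blocked k j N \<le> num_run_free k (N - int (k * j))"
proof -
  have "num_blocked k j (N - int (k * j)) \<le> num_run_free k (N - int (k * j) - int j)"
    unfolding num_blocked_def num_run_free_def blocked_comps_def
    by (simp add: card_mono finite_run_free_comps)
  then show ?thesis using num_blocked_rec[OF assms, of N] by simp
qed

lemma sum_int_upper_Suc:
  fixes f :: "int \<Rightarrow> real"
  assumes "0 \<le> M"
  shows "(\<Sum>m\<in>{0..<M + 1}. f m) = (\<Sum>m\<in>{0..<M}. f m) + f M"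
proof -
  have "{0..<M + 1} = insert M {0..<M}" using assms by auto
  then show ?thesis by simp
qed

text \<open>Compositions of \<open>n < k\<close> are too short to contain a run of length \<open>k\<close>, so nothing is blocked and
  the partial sums double at each step. This also counts all compositions, by choosing \<open>k\<close> large.\<close>
lemma num_run_free_small:
  assumes "1 \<le> n" "n < k"
  shows "num_run_free k (int n) = 2 ^ (n - 1)"
proof -
  have "n < k \<longrightarrow> (\<Sum>m\<in>{0..<int n}. num_run_free k m) = 2 ^ (n - 1) \<and> num_run_free k (int n) = 2 ^ (n - 1)"
    using assms(1)
  proof (induction n rule: nat_induct_at_least)
    case base
    show ?case
    proof
      assume k: "1 < k"
      have "{0..<int 1} = {0}" by auto
      then have s: "(\<Sum>m\<in>{0..<int 1}. num_run_free k m) = 1" using num_run_free_0[of k] k by simp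
      have "num_blocked k 1 1 = 0"
        using num_blocked_le[of k 1 1] num_blocked_nonneg[of k 1 1] num_run_free_neg[of "1 - int k" k] k by simp
      with s show "(\<Sum>m\<in>{0..<int 1}. num_run_free k m) = 2 ^ (1 - 1) \<and> num_run_free k (int 1) = 2 ^ (1 - 1)"
        using num_run_free_first_part[of k 1] k by simp
    qed
  next
    case (Suc n)
    show ?case
    proof
      assume k: "Suc n < k"
      with Suc have IH: "(\<Sum>m\<in>{0..<int n}. num_run_free k m) = 2 ^ (n - 1)" "num_run_free k (int n) = 2 ^ (n - 1)"
        by auto
      have s: "(\<Sum>m\<in>{0..<int (Suc n)}. num_run_free k m) = 2 ^ (Suc n - 1)"
        using sum_int_upper_Suc[of "int n" "num_run_free k"] IH Suc.hyps
        by (cases n) (auto simp: add.commute)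
      have "num_blocked k j (int (Suc n)) = 0" if "1 \<le> j" for j
      proof -
        have "k * 1 \<le> k * j" using that by (intro mult_le_mono) auto
        then have "int (Suc n) - int (k * j) < 0" using k by linarith
        then show ?thesis
          using num_blocked_le[of k j "int (Suc n)"] num_blocked_nonneg[of k j "int (Suc n)"] num_run_free_neg k that
          by fastforce
      qed
      then have "(\<Sum>j\<in>{1..nat (int (Suc n))}. num_blocked k j (int (Suc n))) = 0" by simp
      with s show "(\<Sum>m\<in>{0..<int (Suc n)}. num_run_free k m) = 2 ^ (Suc n - 1) \<and>
          num_run_free k (int (Suc n)) = 2 ^ (Suc n - 1)"
        using num_run_free_first_part[of k "int (Suc n)"] k by simp
    qed
  qed
  with assms show ?thesis by simp
qed

lemma card_compositions:
  assumes "1 \<le> n"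
  shows "card (compositions n) = 2 ^ (n - 1)"
proof -
  have "run_free_comps (Suc n) (int n) = compositions n"
    using length_composition_le by (auto simp: run_free_comps_eq_compositions intro!: run_free_short le_imp_less_Suc)
  with num_run_free_small[of n "Suc n"] assms have "real (card (compositions n)) = real (2 ^ (n - 1))"
    by (simp add: num_run_free_def)
  then show ?thesis by (simp only: of_nat_eq_iff)
qed

section \<open>The recurrence and its error term\<close>

definition total_blocked :: "nat \<Rightarrow> int \<Rightarrow> real" where
  "total_blocked k N = (\<Sum>j\<in>{1..nat N}. num_blocked k j N)"

text \<open>What remains of the total after the leading part \<open>a(N - k) - a(N - k - 1)\<close> of the term \<open>j = 1\<close>.\<close>
definition block_error :: "nat \<Rightarrow> int \<Rightarrow> real" where
  "block_error k N = total_blocked k N - (num_run_free k (N - int k) - num_run_free k (N - int k - 1))"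

text \<open>The difference of the first-part decompositions of \<open>N\<close> and \<open>N - 1\<close>, which removes the long sum.\<close>
lemma num_run_free_step:
  assumes "0 < k" "2 \<le> N"
  shows "num_run_free k N = 2 * num_run_free k (N - 1) - total_blocked k N + total_blocked k (N - 1)"
proof -
  have "(\<Sum>m\<in>{0..<N}. num_run_free k m) = (\<Sum>m\<in>{0..<N - 1}. num_run_free k m) + num_run_free k (N - 1)"
    using sum_int_upper_Suc[of "N - 1" "num_run_free k"] assms by simp
  then show ?thesis
    using num_run_free_first_part[of k N] num_run_free_first_part[of k "N - 1"] assms
    by (simp add: total_blocked_def)
qed

text \<open>The remainder is \<open>b\<^sub>1(N - k)\<close> together with all \<open>b\<^sub>j(N)\<close> for \<open>j \<ge> 2\<close>. Both only involve
  compositions of size at most \<open>N - 2 k\<close>; the sizes \<open>N - k j\<close> are distinct, so the second part is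
  dominated by the sum over all sizes.\<close>
lemma block_error_bounds:
  assumes "0 < k" "1 \<le> N"
  shows "0 \<le> block_error k N"
    and "block_error k N \<le> num_run_free k (N - int (2 * k)) + (\<Sum>m\<in>{0..N - int (2 * k)}. num_run_free k m)"
proof -
  let ?a = "num_run_free k"
  have "{1..nat N} = insert 1 {2..nat N}" using assms by auto
  then have "total_blocked k N = num_blocked k 1 N + (\<Sum>j\<in>{2..nat N}. num_blocked k j N)"
    by (simp add: total_blocked_def)
  then have e: "block_error k N = num_blocked k 1 (N - int k) + (\<Sum>j\<in>{2..nat N}. num_blocked k j N)"
    using num_blocked_rec[of k 1 N] assms by (simp add: block_error_def)
  show "0 \<le> block_error k N"
    unfolding e by (intro add_nonneg_nonneg sum_nonneg num_blocked_nonneg)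
  have "num_blocked k 1 (N - int k) \<le> ?a (N - int (2 * k))"
    using num_blocked_le[of k 1 "N - int k"] assms by (simp add: algebra_simps)
  moreover have "(\<Sum>j\<in>{2..nat N}. num_blocked k j N) \<le> (\<Sum>m\<in>{0..N - int (2 * k)}. ?a m)"
  proof -
    let ?g = "\<lambda>j. N - int (k * j)"
    let ?J = "{j\<in>{2..nat N}. 0 \<le> ?g j}"
    have "(\<Sum>j\<in>{2..nat N}. num_blocked k j N) \<le> (\<Sum>j\<in>{2..nat N}. ?a (?g j))"
      using assms by (intro sum_mono num_blocked_le) auto
    also have "\<dots> = (\<Sum>j\<in>?J. ?a (?g j))"
      by (intro sum.mono_neutral_right ballI) (auto intro!: num_run_free_neg)
    also have "\<dots> = (\<Sum>m\<in>?g ` ?J. ?a m)"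
      using assms by (subst sum.reindex) (auto simp: inj_on_def)
    also have "\<dots> \<le> (\<Sum>m\<in>{0..N - int (2 * k)}. ?a m)"
    proof (rule sum_mono2)
      have "int (k * 2) \<le> int (k * j)" if "2 \<le> j" for j
        using that by (intro iffD2[OF of_nat_le_iff] mult_le_mono) auto
      then show "?g ` ?J \<subseteq> {0..N - int (2 * k)}" by (fastforce simp: mult.commute)
    qed (auto simp: num_run_free_nonneg)
    finally show ?thesis .
  qed
  ultimately show "block_error k N \<le> ?a (N - int (2 * k)) + (\<Sum>m\<in>{0..N - int (2 * k)}. ?a m)"
    unfolding e by linarith
qed

lemma sum_le_of_geometric_growth:
  fixes f :: "int \<Rightarrow> real"
  assumes "\<And>m. 0 \<le> f m" "f 0 \<le> 2 * f 1" "\<And>m. 1 \<le> m \<Longrightarrow> m < M \<Longrightarrow> f m \<le> 2 / 3 * f (m + 1)"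
  shows "(\<Sum>m\<in>{0..M}. f m) \<le> 3 * f M"
proof (cases "0 \<le> M")
  case True
  then show ?thesis
    using assms(3)
  proof (induction M rule: int_ge_induct)
    case base
    then show ?case using assms(1)[of 0] by simp
  next
    case (step M)
    have eq: "{0..M + 1} = insert (M + 1) {0..M}" using step.hyps by auto
    have "(\<Sum>m\<in>{0..M}. f m) \<le> 2 * f (M + 1)"
    proof (cases "M = 0")
      case True
      then show ?thesis using assms(2) by simp
    next
      case False
      then have "f M \<le> 2 / 3 * f (M + 1)" using step.hyps step.prems by simp
      moreover have "(\<Sum>m\<in>{0..M}. f m) \<le> 3 * f M" using step by simp
      ultimately show ?thesis by linarith
    qed
    then show ?case by (simp add: eq)
  qed
next
  case False
  then show ?thesis using assms(1)[of M] by simp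
qed

text \<open>For \<open>N \<ge> 1\<close> this is half the probability that a random composition of \<open>N\<close> has no run of
  length \<open>k\<close>. The value at \<open>N = 0\<close> is exceptional: it is \<open>1\<close>, twice the value at \<open>N = 1\<close>, because
  there are \<open>2 ^ (N - 1)\<close> compositions of \<open>N\<close> only for \<open>N \<ge> 1\<close>.\<close>
definition scaled :: "nat \<Rightarrow> int \<Rightarrow> real" where
  "scaled k N = num_run_free k N * 2 powi (- N)"

lemma num_run_free_shift: "num_run_free k (N - int d) * 2 powi (- N) = scaled k (N - int d) / 2 ^ d"
proof -
  have "(2::real) powi (- (N - int d)) = 2 powi (- N) * 2 ^ d"
    by (simp add: power_int_add[of 2 "- N" "int d", simplified])
  then show ?thesis by (simp add: scaled_def)
qed

lemma scaled_nonneg: "0 \<le> scaled k N"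
  by (simp add: scaled_def num_run_free_nonneg)

lemma scaled_neg: "N < 0 \<Longrightarrow> scaled k N = 0"
  by (simp add: scaled_def num_run_free_neg)

lemma scaled_0: "0 < k \<Longrightarrow> scaled k 0 = 1"
  by (simp add: scaled_def num_run_free_0)

lemma scaled_1: "2 \<le> k \<Longrightarrow> scaled k 1 = 1 / 2"
  using num_run_free_small[of 1 k] by (simp add: scaled_def power_int_minus)

text \<open>If the counts grow by a factor of at least \<open>3/2\<close> up to size \<open>N - 2 k\<close>, the sum in the error bound
  is dominated by its last term. The growth hypothesis is discharged later, inside the induction that
  controls the ratios.\<close>
lemma block_error_le:
  assumes "2 \<le> k" "1 \<le> N"
    and growth: "\<And>m. 1 \<le> m \<Longrightarrow> m < N - int (2 * k) \<Longrightarrow> scaled k m \<le> 4 / 3 * scaled k (m + 1)"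
  shows "block_error k N * 2 powi (- N) \<le> 4 * (1 / 2 ^ k)\<^sup>2 * scaled k (N - int (2 * k))"
proof -
  let ?a = "num_run_free k"
  have "(\<Sum>m\<in>{0..N - int (2 * k)}. ?a m) \<le> 3 * ?a (N - int (2 * k))"
  proof (rule sum_le_of_geometric_growth)
    show "?a 0 \<le> 2 * ?a 1"
      using num_run_free_0[of k] num_run_free_small[of 1 k] assms by simp
    fix m assume m: "1 \<le> m" "m < N - int (2 * k)"
    have "scaled k (m + 1 - int 1) \<le> 4 / 3 * scaled k (m + 1)" using growth[of m] m by simp
    then have "2 * (?a (m + 1 - int 1) * 2 powi (- (m + 1))) \<le> 4 / 3 * (?a (m + 1) * 2 powi (- (m + 1)))"
      by (subst num_run_free_shift) (simp add: scaled_def)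
    then have "?a m * 2 powi (- (m + 1)) \<le> (2 / 3 * ?a (m + 1)) * 2 powi (- (m + 1))" by simp
    then show "?a m \<le> 2 / 3 * ?a (m + 1)"
      by (subst (asm) mult_le_cancel_right) (auto simp: not_less[symmetric] dest: order.strict_trans1)
  qed (rule num_run_free_nonneg)
  then have "block_error k N \<le> 4 * ?a (N - int (2 * k))"
    using block_error_bounds(2)[of k N] assms by simp
  then have "block_error k N * 2 powi (- N) \<le> 4 * (?a (N - int (2 * k)) * 2 powi (- N))"
    by (simp add: mult_right_mono flip: mult.assoc)
  also have "\<dots> = 4 * (1 / 2 ^ k)\<^sup>2 * scaled k (N - int (2 * k))"
    by (subst num_run_free_shift) (simp add: power_mult power2_eq_square power_mult_distrib power_even_eq mult.commute)
  finally show ?thesis .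
qed

text \<open>The recurrence for the scaled counts. The coefficients \<open>1, -1, 1/4\<close> are those of \<open>(1 - z/2)\<^sup>2\<close>: one
  factor comes from \<open>a(N - k) - a(N - k - 1)\<close>, the other from differencing in \<open>N\<close>. They add up to
  \<open>1/4\<close>, the decay rate in units of \<open>\<epsilon>\<close>.\<close>
lemma scaled_step:
  assumes "2 \<le> k" "2 \<le> N"
    and growth: "\<And>m. 1 \<le> m \<Longrightarrow> m < N - 1 \<Longrightarrow> scaled k m \<le> 4 / 3 * scaled k (m + 1)"
  defines "\<epsilon> \<equiv> 1 / 2 ^ k :: real"
  shows "\<bar>scaled k N - scaled k (N - 1)
           + \<epsilon> * (scaled k (N - int k) - scaled k (N - int k - 1) + scaled k (N - int k - 2) / 4)\<bar>
         \<le> 4 * \<epsilon>\<^sup>2 * scaled k (N - int (2 * k)) + 2 * \<epsilon>\<^sup>2 * scaled k (N - 1 - int (2 * k))"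
proof -
  let ?a = "num_run_free k" and ?e = "block_error k" and ?t = "2 powi (- N) :: real"
  have t: "?a (N - 1) * ?t = scaled k (N - 1) / 2"
    "?a (N - int k) * ?t = scaled k (N - int k) * \<epsilon>"
    "?a (N - int k - 1) * ?t = scaled k (N - int k - 1) * \<epsilon> / 2"
    "?a (N - int k - 2) * ?t = scaled k (N - int k - 2) * \<epsilon> / 4"
    using num_run_free_shift[of k N 1] num_run_free_shift[of k N k]
      num_run_free_shift[of k N "k + 1"] num_run_free_shift[of k N "k + 2"]
    by (simp_all add: \<epsilon>_def algebra_simps)
  have t': "(2::real) powi (- (N - 1)) = 2 * ?t"
    using power_int_add[of "2::real" 1 "- N"] by simp
  have "?a N = 2 * ?a (N - 1) - ?a (N - int k) + 2 * ?a (N - int k - 1) - ?a (N - int k - 2)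
      - ?e N + ?e (N - 1)"
    using num_run_free_step[of k N] assms by (simp add: block_error_def algebra_simps)
  then have "?a N * ?t = 2 * (?a (N - 1) * ?t) - ?a (N - int k) * ?t + 2 * (?a (N - int k - 1) * ?t)
      - ?a (N - int k - 2) * ?t - ?e N * ?t + ?e (N - 1) * ?t"
    by (simp only: ring_distribs mult.assoc)
  then have eq: "scaled k N - scaled k (N - 1)
           + \<epsilon> * (scaled k (N - int k) - scaled k (N - int k - 1) + scaled k (N - int k - 2) / 4)
        = ?e (N - 1) * ?t - ?e N * ?t"
    unfolding t by (simp add: scaled_def[of k N] algebra_simps)
  have b1: "?e N * ?t \<le> 4 * \<epsilon>\<^sup>2 * scaled k (N - int (2 * k))"
    using block_error_le[of k N] assms by (simp add: \<epsilon>_def)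
  have b2: "?e (N - 1) * ?t \<le> 2 * \<epsilon>\<^sup>2 * scaled k (N - 1 - int (2 * k))"
    using block_error_le[of k "N - 1"] assms t' by (simp add: \<epsilon>_def)
  have "0 \<le> ?e N * ?t" "0 \<le> ?e (N - 1) * ?t"
    using block_error_bounds(1)[of k] assms by auto
  moreover have "0 \<le> 4 * \<epsilon>\<^sup>2 * scaled k (N - int (2 * k))" "0 \<le> 2 * \<epsilon>\<^sup>2 * scaled k (N - 1 - int (2 * k))"
    by (simp_all add: scaled_nonneg)
  ultimately show ?thesis unfolding eq using b1 b2 by linarith
qed

section \<open>Ratios of consecutive terms\<close>

text \<open>A sequence whose relative increments are at most \<open>\<delta>\<close> changes over \<open>d\<close> steps by at most a factor
  \<open>(1 - \<delta>) ^ d \<ge> 1 - d \<delta>\<close> in either direction, since \<open>(1 + \<delta>) (1 - \<delta>) \<le> 1\<close>.\<close>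
lemma nearby_terms:
  fixes f :: "int \<Rightarrow> real"
  assumes "0 \<le> \<delta>" "\<delta> * real d \<le> 1 / 2"
    and nonneg: "\<And>m. 0 \<le> f m"
    and step: "\<And>m. M - int d < m \<Longrightarrow> m \<le> M \<Longrightarrow> \<bar>f m - f (m - 1)\<bar> \<le> \<delta> * f (m - 1)"
  shows "\<bar>f (M - int d) - f M\<bar> \<le> 2 * (\<delta> * real d) * f M"
proof (cases "d = 0")
  case False
  define q where "q = 1 - \<delta> * real d"
  have "\<delta> * 1 \<le> \<delta> * real d" using assms(1) False by (intro mult_left_mono) auto
  then have d1: "\<delta> \<le> 1 / 2" using assms(2) by linarith
  have q: "q \<le> (1 - \<delta>) ^ d"
    using Bernoulli_inequality[of "- \<delta>" d] d1 by (simp add: q_def mult.commute)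
  have *: "(1 - \<delta>) ^ i * f (M - int d) \<le> f (M - int d + int i) \<and>
      (1 - \<delta>) ^ i * f (M - int d + int i) \<le> f (M - int d)" if "i \<le> d" for i
    using that
  proof (induction i)
    case (Suc i)
    let ?x = "f (M - int d + int i)" and ?y = "f (M - int d + int (Suc i))"
    have "\<bar>?y - ?x\<bar> \<le> \<delta> * ?x"
      using step[of "M - int d + int (Suc i)"] Suc.prems by (simp add: algebra_simps)
    then have a: "(1 - \<delta>) * ?x \<le> ?y" "?y \<le> (1 + \<delta>) * ?x" by (auto simp: algebra_simps abs_le_iff)
    have "(1 - \<delta>) * ?y \<le> (1 - \<delta>) * ((1 + \<delta>) * ?x)"
      using a(2) d1 by (intro mult_left_mono) auto
    also have "\<dots> = ?x - \<delta>\<^sup>2 * ?x" by (simp add: algebra_simps power2_eq_square)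
    also have "\<dots> \<le> ?x" using nonneg by simp
    finally have b: "(1 - \<delta>) * ?y \<le> ?x" .
    have "(1 - \<delta>) ^ Suc i * f (M - int d) \<le> (1 - \<delta>) * ?x"
      using Suc d1 by (simp add: mult_left_mono mult.assoc)
    moreover have "(1 - \<delta>) ^ Suc i * ?y \<le> (1 - \<delta>) ^ i * ?x"
      using mult_left_mono[OF b, of "(1 - \<delta>) ^ i"] d1 by (simp add: mult_ac)
    ultimately show ?case using a(1) Suc by linarith
  qed simp
  have lower: "q * f M \<le> f (M - int d)"
    using *[of d] mult_right_mono[OF q nonneg[of M]] by simp
  have "q * f (M - int d) \<le> f M"
    using *[of d] mult_right_mono[OF q nonneg[of "M - int d"]] by simp
  then have "(1 + 2 * (\<delta> * real d)) * (q * f (M - int d)) \<le> (1 + 2 * (\<delta> * real d)) * f M"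
    using assms(1) by (intro mult_left_mono) auto
  moreover have "1 * f (M - int d) \<le> ((1 + 2 * (\<delta> * real d)) * q) * f (M - int d)"
  proof (rule mult_right_mono[OF _ nonneg])
    have "(\<delta> * real d) * (\<delta> * real d) \<le> 1 / 2 * (\<delta> * real d)"
      using assms(1,2) by (intro mult_right_mono) auto
    then show "1 \<le> (1 + 2 * (\<delta> * real d)) * q" by (simp add: q_def algebra_simps)
  qed
  ultimately have upper: "f (M - int d) \<le> (1 + 2 * (\<delta> * real d)) * f M" by (simp add: mult.assoc)
  have "0 \<le> (\<delta> * real d) * f M" using assms(1) nonneg by simp
  then show ?thesis using lower upper by (simp add: q_def algebra_simps abs_le_iff)
qed simp

text \<open>The numerical fact that makes \<open>k \<epsilon>\<close> small enough for the induction on the ratios.\<close>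
lemma linear_le_two_power:
  assumes "16 \<le> k"
  shows "160 * (real k + 1) \<le> 2 ^ k"
  using assms by (induction k rule: nat_induct_at_least) auto

context
  fixes k :: nat and \<epsilon> :: real
  assumes k_ge: "16 \<le> k"
  defines "\<epsilon> \<equiv> 1 / 2 ^ k"
begin

lemma eps_pos: "0 < \<epsilon>"
  by (simp add: \<epsilon>_def)

lemma eps_small: "\<epsilon> * (real k + 1) \<le> 1 / 160"
  using linear_le_two_power[OF k_ge] by (simp add: \<epsilon>_def field_simps)

lemma eps_le: "\<epsilon> \<le> 1 / 2720"
proof -
  have "\<epsilon> * 17 \<le> \<epsilon> * (real k + 1)" using k_ge eps_pos by (intro mult_left_mono) auto
  then show ?thesis using eps_small by linarith
qed

text \<open>The recurrence for \<open>p(M + 1)\<close> reaches back to \<open>p(M - 2 k)\<close>, hence the window of length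
  \<open>2 k + 2\<close>. The hypothesis on the increments is the induction hypothesis of \<open>scaled_ratio_crude\<close>.\<close>
lemma scaled_nearby:
  assumes "1 \<le> m" "m \<le> M" "M - m \<le> 2 * int k + 2"
    and step: "\<And>m. 2 \<le> m \<Longrightarrow> m \<le> M \<Longrightarrow> \<bar>scaled k m - scaled k (m - 1)\<bar> \<le> 8 * \<epsilon> * scaled k (m - 1)"
  shows "\<bar>scaled k m - scaled k M\<bar> \<le> 32 * (\<epsilon> * (real k + 1)) * scaled k M"
proof -
  define d where "d = nat (M - m)"
  have m: "m = M - int d" using assms by (simp add: d_def)
  have "real d \<le> 2 * (real k + 1)" using assms by (simp add: d_def)
  then have "8 * \<epsilon> * real d \<le> 8 * \<epsilon> * (2 * (real k + 1))"
    using eps_pos by (intro mult_left_mono) auto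
  then have d: "8 * \<epsilon> * real d \<le> 16 * (\<epsilon> * (real k + 1))" by (simp add: mult_ac)
  have "\<bar>scaled k (M - int d) - scaled k M\<bar> \<le> 2 * (8 * \<epsilon> * real d) * scaled k M"
  proof (rule nearby_terms)
    show "8 * \<epsilon> * real d \<le> 1 / 2" using d eps_small by linarith
  qed (use assms m eps_pos scaled_nonneg in auto)
  also have "\<dots> \<le> 32 * (\<epsilon> * (real k + 1)) * scaled k M"
    using d by (intro mult_right_mono scaled_nonneg) auto
  finally show ?thesis by (simp add: m)
qed

text \<open>A one-sided version that also covers indices \<open>m \<le> 0\<close>. The factor \<open>12/5\<close> is twice the \<open>6/5\<close>
  obtained for positive indices, because the value at \<open>0\<close> is twice the value at \<open>1\<close>.\<close>
lemma scaled_le_later: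
  assumes "1 \<le> M" "m \<le> M" "M - m \<le> 2 * int k + 2"
    and step: "\<And>m. 2 \<le> m \<Longrightarrow> m \<le> M \<Longrightarrow> \<bar>scaled k m - scaled k (m - 1)\<bar> \<le> 8 * \<epsilon> * scaled k (m - 1)"
  shows "scaled k m \<le> 12 / 5 * scaled k M"
proof -
  have near: "scaled k i \<le> 6 / 5 * scaled k M" if "1 \<le> i" "i \<le> M" "M - i \<le> 2 * int k + 2" for i
  proof -
    have "32 * (\<epsilon> * (real k + 1)) * scaled k M \<le> 1 / 5 * scaled k M"
      using eps_small by (intro mult_right_mono scaled_nonneg) auto
    then show ?thesis using scaled_nearby[OF that step] by (auto simp: abs_le_iff)
  qed
  consider "m < 0" | "m = 0" | "1 \<le> m" by linarith
  then show ?thesis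
  proof cases
    case 1
    then show ?thesis using scaled_nonneg[of k M] by (simp add: scaled_neg)
  next
    case 2
    then show ?thesis using near[of 1] assms scaled_0[of k] scaled_1[of k] k_ge by simp
  next
    case 3
    then show ?thesis using near[of m] assms scaled_nonneg[of k M] by simp
  qed
qed

lemma scaled_error:
  assumes "2 \<le> N"
    and step: "\<And>m. 2 \<le> m \<Longrightarrow> m \<le> N - 1 \<Longrightarrow> \<bar>scaled k m - scaled k (m - 1)\<bar> \<le> 8 * \<epsilon> * scaled k (m - 1)"
  shows "\<bar>scaled k N - scaled k (N - 1)
           + \<epsilon> * (scaled k (N - int k) - scaled k (N - int k - 1) + scaled k (N - int k - 2) / 4)\<bar>
         \<le> 15 * \<epsilon>\<^sup>2 * scaled k (N - 1)"
proof -
  have growth: "scaled k m \<le> 4 / 3 * scaled k (m + 1)" if "1 \<le> m" "m < N - 1" for m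
  proof -
    have "8 * \<epsilon> * scaled k m \<le> 1 / 4 * scaled k m"
      using eps_le by (intro mult_right_mono scaled_nonneg) auto
    then show ?thesis using step[of "m + 1"] that by (auto simp: abs_le_iff)
  qed
  have "4 * \<epsilon>\<^sup>2 * scaled k (N - int (2 * k)) \<le> 4 * \<epsilon>\<^sup>2 * (12 / 5 * scaled k (N - 1))"
    "2 * \<epsilon>\<^sup>2 * scaled k (N - 1 - int (2 * k)) \<le> 2 * \<epsilon>\<^sup>2 * (12 / 5 * scaled k (N - 1))"
    using assms k_ge by (intro mult_left_mono scaled_le_later; simp)+
  moreover have "0 \<le> \<epsilon>\<^sup>2 * scaled k (N - 1)" by (simp add: scaled_nonneg)
  moreover have "\<bar>scaled k N - scaled k (N - 1)
      + \<epsilon> * (scaled k (N - int k) - scaled k (N - int k - 1) + scaled k (N - int k - 2) / 4)\<bar>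
    \<le> 4 * \<epsilon>\<^sup>2 * scaled k (N - int (2 * k)) + 2 * \<epsilon>\<^sup>2 * scaled k (N - 1 - int (2 * k))"
    unfolding \<epsilon>_def using k_ge assms(1) growth by (intro scaled_step) auto
  ultimately show ?thesis by (simp add: algebra_simps)
qed

text \<open>Strong induction: given the bound for smaller indices, every term on the right of the recurrence is
  at most \<open>12/5\<close> of \<open>p(N - 1)\<close>, which bounds the bracket by \<open>27/5\<close> of \<open>p(N - 1)\<close>; with the error term
  this stays below the constant \<open>8\<close>.\<close>
lemma scaled_ratio_crude:
  assumes "2 \<le> N"
  shows "\<bar>scaled k N - scaled k (N - 1)\<bar> \<le> 8 * \<epsilon> * scaled k (N - 1)"
  using assms
proof (induction "nat N" arbitrary: N rule: less_induct)
  case less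
  have step: "\<bar>scaled k m - scaled k (m - 1)\<bar> \<le> 8 * \<epsilon> * scaled k (m - 1)"
    if "2 \<le> m" "m \<le> N - 1" for m
    using less.hyps[of m] that by simp
  let ?s = "scaled k (N - 1)"
  let ?T = "scaled k (N - int k) - scaled k (N - int k - 1) + scaled k (N - int k - 2) / 4"
  have "scaled k i \<le> 12 / 5 * ?s" if "i \<in> {N - int k, N - int k - 1, N - int k - 2}" for i
    using that less.prems k_ge step by (intro scaled_le_later) auto
  from this[of "N - int k"] this[of "N - int k - 1"] this[of "N - int k - 2"]
  have "\<bar>?T\<bar> \<le> 27 / 5 * ?s"
    using scaled_nonneg[of k "N - int k"] scaled_nonneg[of k "N - int k - 1"]
      scaled_nonneg[of k "N - int k - 2"] scaled_nonneg[of k "N - 1"]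
    unfolding abs_le_iff insert_iff by linarith
  then have "\<bar>\<epsilon> * ?T\<bar> \<le> \<epsilon> * (27 / 5 * ?s)"
    using eps_pos by (simp add: abs_mult)
  moreover have "15 * \<epsilon>\<^sup>2 * ?s \<le> \<epsilon> * ?s"
  proof (rule mult_right_mono[OF _ scaled_nonneg])
    have "\<epsilon> * (15 * \<epsilon>) \<le> \<epsilon> * 1" using eps_le eps_pos by (intro mult_left_mono) auto
    then show "15 * \<epsilon>\<^sup>2 \<le> \<epsilon>" by (simp add: power2_eq_square mult_ac)
  qed
  moreover have "0 \<le> \<epsilon> * ?s" using eps_pos scaled_nonneg by simp
  ultimately show ?case using scaled_error[OF less.prems step] by (auto simp: abs_le_iff)
qed

text \<open>For \<open>N \<ge> k + 3\<close> the three indices in the bracket are positive, so each value there agrees with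
  \<open>p(N - 1)\<close> up to a relative error \<open>O(k \<epsilon>)\<close>, and the coefficients add up to \<open>1/4\<close>.\<close>
lemma scaled_ratio_fine:
  assumes "int k + 3 \<le> N"
  shows "\<bar>scaled k N - (1 - \<epsilon> / 4) * scaled k (N - 1)\<bar> \<le> 200 * real k * \<epsilon>\<^sup>2 * scaled k (N - 1)"
proof -
  let ?s = "scaled k (N - 1)" and ?\<kappa> = "32 * (\<epsilon> * (real k + 1)) * scaled k (N - 1)"
  let ?T = "scaled k (N - int k) - scaled k (N - int k - 1) + scaled k (N - int k - 2) / 4"
  have "\<bar>scaled k i - ?s\<bar> \<le> ?\<kappa>" if "i \<in> {N - int k, N - int k - 1, N - int k - 2}" for i
    using that assms k_ge by (intro scaled_nearby scaled_ratio_crude) auto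
  from this[of "N - int k"] this[of "N - int k - 1"] this[of "N - int k - 2"]
  have "\<bar>?T - ?s / 4\<bar> \<le> 9 / 4 * ?\<kappa>" by auto
  then have "\<bar>\<epsilon> * (?T - ?s / 4)\<bar> \<le> \<epsilon> * (9 / 4 * ?\<kappa>)"
    using eps_pos by (simp add: abs_mult)
  also have "\<epsilon> * (9 / 4 * ?\<kappa>) = 72 * (real k + 1) * (\<epsilon>\<^sup>2 * ?s)"
    by (simp add: power2_eq_square)
  finally have "\<bar>\<epsilon> * (?T - ?s / 4)\<bar> \<le> 72 * (real k + 1) * (\<epsilon>\<^sup>2 * ?s)" .
  moreover have "\<bar>scaled k N - ?s + \<epsilon> * ?T\<bar> \<le> 15 * \<epsilon>\<^sup>2 * ?s"
    using assms k_ge by (intro scaled_error scaled_ratio_crude) auto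
  moreover have "scaled k N - (1 - \<epsilon> / 4) * ?s = (scaled k N - ?s + \<epsilon> * ?T) - \<epsilon> * (?T - ?s / 4)"
    by (simp add: algebra_simps)
  moreover have "(72 * (real k + 1) + 15) * (\<epsilon>\<^sup>2 * ?s) \<le> 200 * real k * (\<epsilon>\<^sup>2 * ?s)"
    using k_ge by (intro mult_right_mono) (auto simp: scaled_nonneg)
  ultimately show ?thesis by (simp add: algebra_simps abs_le_iff)
qed

lemma scaled_pos:
  assumes "1 \<le> n"
  shows "0 < scaled k (int n)"
  using assms
proof (induction n rule: nat_induct_at_least)
  case base
  then show ?case using scaled_1[of k] k_ge by simp
next
  case (Suc n)
  have "8 * \<epsilon> * scaled k (int n) \<le> 1 / 2 * scaled k (int n)"
    using eps_le by (intro mult_right_mono scaled_nonneg) auto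
  moreover have "\<bar>scaled k (int (Suc n)) - scaled k (int n)\<bar> \<le> 8 * \<epsilon> * scaled k (int n)"
    using scaled_ratio_crude[of "int (Suc n)"] Suc.hyps by simp
  ultimately show ?case using Suc.IH by linarith
qed

text \<open>The crude bound serves for the steps up to index \<open>k + 2\<close>, before the decay has reached its stationary
  rate; the fine bound serves afterwards.\<close>
lemma ln_scaled_increment:
  assumes "1 \<le> n"
  defines "D \<equiv> ln (scaled k (int (Suc n))) - ln (scaled k (int n)) + \<epsilon> / 4"
  shows "\<bar>D\<bar> \<le> 17 * \<epsilon>"
    and "k + 2 \<le> n \<Longrightarrow> \<bar>D\<bar> \<le> 328 * real k * \<epsilon>\<^sup>2"
proof -
  let ?s = "scaled k (int n)" and ?s' = "scaled k (int (Suc n))"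
  define x where "x = ?s' / ?s - 1"
  have pos: "0 < ?s" "0 < ?s'" using assms scaled_pos[of n] scaled_pos[of "Suc n"] by auto
  have x: "\<bar>x\<bar> \<le> 8 * \<epsilon>"
    using scaled_ratio_crude[of "int (Suc n)"] assms pos
    by (simp add: x_def abs_le_iff field_simps)
  have D: "D = (ln (1 + x) - x) + (x + \<epsilon> / 4)"
    using pos by (simp add: D_def x_def ln_div)
  have ln: "\<bar>ln (1 + x) - x\<bar> \<le> 2 * x\<^sup>2"
    using x eps_le by (intro abs_ln_one_plus_x_minus_x_bound) auto
  have "x\<^sup>2 \<le> (8 * \<epsilon>)\<^sup>2" using x eps_pos by (intro abs_le_square_iff[THEN iffD1]) auto
  with ln have ln': "\<bar>ln (1 + x) - x\<bar> \<le> 128 * \<epsilon>\<^sup>2" by (simp add: power_mult_distrib)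
  have "128 * \<epsilon> * \<epsilon> \<le> 1 * \<epsilon>" using eps_le eps_pos by (intro mult_right_mono) auto
  then show "\<bar>D\<bar> \<le> 17 * \<epsilon>"
    using ln' x eps_pos unfolding D power2_eq_square by linarith
  assume "k + 2 \<le> n"
  then have "\<bar>?s' - (1 - \<epsilon> / 4) * ?s\<bar> \<le> 200 * real k * \<epsilon>\<^sup>2 * ?s"
    using scaled_ratio_fine[of "int (Suc n)"] by simp
  moreover have "?s' - (1 - \<epsilon> / 4) * ?s = (x + \<epsilon> / 4) * ?s"
    using pos by (simp add: x_def field_simps)
  ultimately have "\<bar>x + \<epsilon> / 4\<bar> * ?s \<le> 200 * real k * \<epsilon>\<^sup>2 * ?s"
    using pos by (simp add: abs_mult)
  then have "\<bar>x + \<epsilon> / 4\<bar> \<le> 200 * real k * \<epsilon>\<^sup>2" using pos by simp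
  moreover have "128 * \<epsilon>\<^sup>2 \<le> 128 * real k * \<epsilon>\<^sup>2"
    using k_ge by (intro mult_right_mono) auto
  ultimately show "\<bar>D\<bar> \<le> 328 * real k * \<epsilon>\<^sup>2"
    using ln' unfolding D by (simp add: algebra_simps abs_le_iff)
qed

lemma ln_scaled_approx:
  assumes "1 \<le> n"
  shows "\<bar>ln (2 * scaled k (int n)) + real n * \<epsilon> / 4\<bar>
    \<le> 17 * real (k + 2) * \<epsilon> + 328 * real n * real k * \<epsilon>\<^sup>2"
proof -
  \<comment> \<open>The minimum counts the steps that use the crude bound, together with the \<open>\<epsilon> / 4\<close> present at \<open>n = 1\<close>.\<close>
  have "\<bar>ln (2 * scaled k (int n)) + real n * \<epsilon> / 4\<bar>
    \<le> 17 * real (min n (k + 2)) * \<epsilon> + 328 * real n * real k * \<epsilon>\<^sup>2"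
    using assms
  proof (induction n rule: nat_induct_at_least)
    case base
    have "0 \<le> 328 * real k * \<epsilon>\<^sup>2" by simp
    moreover have "ln (2 * scaled k (int 1)) = 0" using scaled_1[of k] k_ge by simp
    ultimately show ?case using eps_pos by simp
  next
    case (Suc n)
    let ?D = "ln (scaled k (int (Suc n))) - ln (scaled k (int n)) + \<epsilon> / 4"
    have "ln (2 * scaled k (int (Suc n))) + real (Suc n) * \<epsilon> / 4
      = (ln (2 * scaled k (int n)) + real n * \<epsilon> / 4) + ?D"
      using scaled_pos[of n] scaled_pos[of "Suc n"] Suc.hyps by (simp add: ln_mult field_simps)
    moreover have "\<bar>?D\<bar> \<le> 17 * real (min (Suc n) (k + 2)) * \<epsilon> - 17 * real (min n (k + 2)) * \<epsilon>
        + 328 * real k * \<epsilon>\<^sup>2"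
    proof (cases "k + 2 \<le> n")
      case True
      then have "min n (k + 2) = k + 2" "min (Suc n) (k + 2) = k + 2" by auto
      then show ?thesis using ln_scaled_increment(2)[of n] Suc.hyps True by simp
    next
      case False
      then have "min n (k + 2) = n" "min (Suc n) (k + 2) = Suc n" by auto
      moreover have "0 \<le> 328 * real k * \<epsilon>\<^sup>2" by simp
      moreover have "17 * real (Suc n) * \<epsilon> - 17 * real n * \<epsilon> = 17 * \<epsilon>" by (simp add: algebra_simps)
      ultimately show ?thesis using ln_scaled_increment(1)[OF Suc.hyps] by (simp only:)
    qed
    moreover have "328 * real (Suc n) * real k * \<epsilon>\<^sup>2 = 328 * real n * real k * \<epsilon>\<^sup>2 + 328 * real k * \<epsilon>\<^sup>2"
      by (simp add: algebra_simps)
    ultimately show ?case using Suc.IH by linarith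
  qed
  also have "17 * real (min n (k + 2)) * \<epsilon> \<le> 17 * real (k + 2) * \<epsilon>"
  proof (rule mult_right_mono)
    have "real (min n (k + 2)) \<le> real (k + 2)" by (simp only: of_nat_le_iff min.cobounded2)
    then show "17 * real (min n (k + 2)) \<le> 17 * real (k + 2)" by (rule mult_left_mono) simp
  qed (use eps_pos in simp)
  finally show ?thesis by simp
qed

end

section \<open>The distribution of the longest run\<close>

lemma prob_longest_run_less:
  assumes "1 \<le> n"
  shows "measure_pmf.prob (random_composition n) {xs. longest_run xs < k} = 2 * scaled k (int n)"
proof -
  have "compositions n \<inter> {xs. longest_run xs < k} = run_free_comps k (int n)"
    using assms by (auto simp: run_free_comps_eq_compositions longest_run_less_iff_run_free)
  then have "measure_pmf.prob (random_composition n) {xs. longest_run xs < k}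
      = num_run_free k (int n) / 2 ^ (n - 1)"
    unfolding random_composition_def
    by (simp add: measure_pmf_of_set compositions_nonempty finite_compositions
        card_compositions[OF assms] num_run_free_def)
  also have "\<dots> = 2 * scaled k (int n)"
    using assms by (cases n) (auto simp: scaled_def power_int_minus field_simps simp flip: of_nat_Suc)
  finally show ?thesis .
qed

text \<open>In the given range \<open>\<epsilon> \<le> n powr (- 3/4)\<close>, so \<open>\<epsilon>\<close> and \<open>n \<epsilon>\<^sup>2\<close> are both at most \<open>1 / sqrt n\<close>, and
  \<open>k \<le> 4 ln n\<close>. The constant is \<open>4 (34 + 328)\<close>.\<close>
lemma ln_prob_approx:
  fixes k n :: nat
  assumes k: "16 \<le> k" and n: "1 \<le> n"
    and range: "3 / 4 * log 2 (real n) \<le> real k" "real k \<le> 2 * log 2 (real n)"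
  shows "\<bar>ln (2 * scaled k (int n)) + real n / 2 ^ (k + 2)\<bar> \<le> 1448 * (ln (real n) / sqrt (real n))"
proof -
  define \<epsilon> :: real where "\<epsilon> = 1 / 2 ^ k"
  have n0: "0 < real n" using n by simp
  have sq: "real n powr (- (1 / 2)) = 1 / sqrt (real n)"
    using n by (simp add: powr_minus powr_half_sqrt field_simps)
  have "real n powr (3 / 4) = 2 powr (3 / 4 * log 2 (real n))"
    using n0 by (simp add: powr_def log_def)
  also have "\<dots> \<le> 2 powr real k" using range(1) by (intro powr_mono) auto
  finally have "real n powr (3 / 4) \<le> 2 ^ k" by (simp add: powr_realpow)
  then have eps: "\<epsilon> \<le> real n powr (- (3 / 4))"
    using n0 by (simp add: \<epsilon>_def powr_minus field_simps)
  have eps0: "0 \<le> \<epsilon>" by (simp add: \<epsilon>_def)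
  have "real n powr (- (3 / 4)) \<le> real n powr (- (1 / 2))"
    using n by (intro powr_mono) auto
  with eps sq have e1: "\<epsilon> \<le> 1 / sqrt (real n)" by simp
  have "real n * \<epsilon>\<^sup>2 \<le> real n powr 1 * (real n powr (- (3 / 4)))\<^sup>2"
    using eps eps0 n0 by (auto intro!: mult_left_mono power_mono)
  also have "\<dots> = real n powr (1 + (- (3 / 4) + - (3 / 4)))"
    by (simp only: power2_eq_square powr_add)
  also have "\<dots> = real n powr (- (1 / 2))" by simp
  finally have e2: "real n * \<epsilon>\<^sup>2 \<le> 1 / sqrt (real n)" using sq by simp
  have "real k * ln 2 \<le> 2 * ln (real n)"
    using range(2) by (simp add: log_def field_simps)
  moreover have "real k * (1 / 2) \<le> real k * ln 2"
    using ln2_ge_two_thirds by (intro mult_left_mono) auto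
  ultimately have kl: "real k \<le> 4 * ln (real n)" by simp
  have "17 * real (k + 2) * \<epsilon> \<le> 34 * real k * (1 / sqrt (real n))"
    using k by (intro mult_mono[OF _ e1 _ eps0]) auto
  moreover have "328 * real n * real k * \<epsilon>\<^sup>2 \<le> 328 * real k * (1 / sqrt (real n))"
    using mult_left_mono[OF e2, of "328 * real k"] by (simp add: mult_ac)
  moreover have "\<bar>ln (2 * scaled k (int n)) + real n * \<epsilon> / 4\<bar>
      \<le> 17 * real (k + 2) * \<epsilon> + 328 * real n * real k * \<epsilon>\<^sup>2"
    unfolding \<epsilon>_def using ln_scaled_approx[OF k n] .
  moreover have "362 * real k * (1 / sqrt (real n)) \<le> 362 * (4 * ln (real n)) * (1 / sqrt (real n))"
    using kl by (intro mult_right_mono) auto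
  ultimately have "\<bar>ln (2 * scaled k (int n)) + real n * \<epsilon> / 4\<bar> \<le> 1448 * (ln (real n) / sqrt (real n))"
    by simp
  then show ?thesis by (simp add: \<epsilon>_def)
qed

lemma exp_perturbation:
  fixes \<eta> b :: real
  assumes "\<bar>\<eta>\<bar> \<le> b" "b \<le> 1 / 2"
  shows "\<bar>exp \<eta> - 1\<bar> \<le> 2 * b"
proof -
  have "exp \<eta> \<le> exp b" using assms by simp
  also have "\<dots> \<le> 1 + 2 * b" using exp_bound_lemma[of b] assms by simp
  finally show ?thesis using exp_ge_add_one_self[of \<eta>] assms unfolding abs_le_iff by linarith
qed

text \<open>The threshold \<open>n \<ge> 2 ^ 22\<close> forces \<open>k \<ge> 16\<close> throughout the range, and the bound on \<open>ln n / sqrt n\<close>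
  makes the logarithmic error at most \<open>1/2\<close>, so that exponentiating it costs only a factor \<open>2\<close>.\<close>
lemma longest_run_distribution_uniform:
  "\<forall>\<^sub>F n in sequentially. \<forall>k::int.
      3 / 4 * log 2 (real n) \<le> real_of_int k \<and> real_of_int k \<le> 2 * log 2 (real n) \<longrightarrow>
      (\<exists>\<epsilon>::real. \<bar>\<epsilon>\<bar> \<le> 2896 * (ln (real n) / sqrt (real n)) \<and>
         measure_pmf.prob (random_composition n) {xs. int (longest_run xs) < k} =
           exp (- (real n / 2 powi (k + 2))) * (1 + \<epsilon>))"
proof -
  have "(\<lambda>n. ln (real n) / real n powr (1 / 2)) \<longlonglongrightarrow> 0"
    using lim_ln_over_power[of "1 / 2"] by simp
  then have "\<forall>\<^sub>F n in sequentially. ln (real n) / real n powr (1 / 2) < 1 / 2896"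
    by (rule order_tendstoD) simp
  moreover have "\<forall>\<^sub>F n in sequentially. 2 ^ 22 \<le> (n :: nat)"
    by (rule eventually_ge_at_top)
  ultimately show ?thesis
  proof eventually_elim
    case (elim n)
    show ?case
    proof (intro allI impI)
      fix k :: int
      assume range: "3 / 4 * log 2 (real n) \<le> real_of_int k \<and> real_of_int k \<le> 2 * log 2 (real n)"
      have n: "1 \<le> n" using elim(2) by simp
      have "(2::real) ^ 22 \<le> real n" using of_nat_mono[OF elim(2), where 'a=real] by simp
      then have "log 2 (2 ^ 22) \<le> log 2 (real n)" using n by (subst log_le_cancel_iff) auto
      moreover have "log 2 ((2::real) ^ 22) = 22" by (subst log_pow_cancel) auto
      ultimately have "22 \<le> log 2 (real n)" by linarith
      with range have "16 \<le> k" by linarith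
      then obtain k' where k': "k = int k'" "16 \<le> k'"
        by (metis nonneg_int_cases of_nat_le_iff of_nat_numeral order_trans zero_le_numeral)
      have small: "ln (real n) / sqrt (real n) < 1 / 2896"
        using elim(1) by (simp only: powr_half_sqrt of_nat_0_le_iff)
      define \<eta> where "\<eta> = ln (2 * scaled k' (int n)) + real n / 2 ^ (k' + 2)"
      have "\<bar>\<eta>\<bar> \<le> 1448 * (ln (real n) / sqrt (real n))"
        unfolding \<eta>_def using range n k' by (intro ln_prob_approx) auto
      then have "\<bar>exp \<eta> - 1\<bar> \<le> 2896 * (ln (real n) / sqrt (real n))"
        using exp_perturbation[of \<eta> "1448 * (ln (real n) / sqrt (real n))"] small by linarith
      moreover have "measure_pmf.prob (random_composition n) {xs. int (longest_run xs) < k}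
          = 2 * scaled k' (int n)"
        using prob_longest_run_less[of n k'] k' n by simp
      moreover have "2 * scaled k' (int n) = exp (- (real n / 2 powi (k + 2))) * (1 + (exp \<eta> - 1))"
      proof -
        have "(2::real) powi (k + 2) = 2 ^ (k' + 2)"
          using power_int_of_nat[of "2::real" "k' + 2"] k'(1) by (simp add: add.commute)
        moreover have "2 * scaled k' (int n) = exp (- (real n / 2 ^ (k' + 2)) + \<eta>)"
          using scaled_pos[OF k'(2) n] by (simp add: \<eta>_def)
        ultimately show ?thesis by (simp only: exp_add) simp
      qed
      ultimately show "\<exists>\<epsilon>::real. \<bar>\<epsilon>\<bar> \<le> 2896 * (ln (real n) / sqrt (real n)) \<and>
         measure_pmf.prob (random_composition n) {xs. int (longest_run xs) < k} =
           exp (- (real n / 2 powi (k + 2))) * (1 + \<epsilon>)"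
        by (intro exI[of _ "exp \<eta> - 1"]) simp
    qed
  qed
qed

text \<open>Because \<open>n = 2 powr \<lfloor>log\<^sub>2 n\<rfloor> * omega n\<close>.\<close>
lemma omega_rescaling:
  assumes "1 \<le> n"
  shows "real n / 2 powi (\<lfloor>log 2 (real n)\<rfloor> + h + 2) = omega n * 2 powi (- h - 2)"
proof -
  let ?l = "log 2 (real n)"
  have "real n = 2 powr (real_of_int \<lfloor>?l\<rfloor> + frac ?l)"
    using assms by (simp add: frac_def)
  also have "\<dots> = 2 powi \<lfloor>?l\<rfloor> * omega n"
    by (simp only: powr_add omega_def) (simp add: powr_real_of_int')
  also have "\<dots> / 2 powi (\<lfloor>?l\<rfloor> + h + 2) = omega n * 2 powi (- h - 2)"
    by (simp add: power_int_add power_int_diff power_int_minus field_simps)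
  finally show ?thesis .
qed

theorem theorem1:
  "(\<exists>C::real. \<forall>\<^sub>F n in sequentially. \<forall>k::int.
      3 / 4 * log 2 (real n) \<le> real_of_int k \<and> real_of_int k \<le> 2 * log 2 (real n) \<longrightarrow>
      (\<exists>\<epsilon>::real. \<bar>\<epsilon>\<bar> \<le> C * (ln (real n) / sqrt (real n)) \<and>
         measure_pmf.prob (random_composition n) {xs. int (longest_run xs) < k} =
           exp (- (real n / 2 powi (k + 2))) * (1 + \<epsilon>)))
   \<and>
   (\<exists>C::real. \<forall>\<^sub>F n in sequentially. \<forall>h::int.
      - (1 / 4) * log 2 (real n) + frac (log 2 (real n)) \<le> real_of_int h \<and>
      real_of_int h \<le> log 2 (real n) + frac (log 2 (real n)) \<longrightarrow>
      (\<exists>\<epsilon>::real. \<bar>\<epsilon>\<bar> \<le> C * (ln (real n) / sqrt (real n)) \<and>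
         measure_pmf.prob (random_composition n)
             {xs. int (longest_run xs) < \<lfloor>log 2 (real n)\<rfloor> + h} =
           exp (- (omega n * 2 powi (- h - 2))) * (1 + \<epsilon>)))"
proof (intro conjI exI[of _ 2896])
  show "\<forall>\<^sub>F n in sequentially. \<forall>h::int.
      - (1 / 4) * log 2 (real n) + frac (log 2 (real n)) \<le> real_of_int h \<and>
      real_of_int h \<le> log 2 (real n) + frac (log 2 (real n)) \<longrightarrow>
      (\<exists>\<epsilon>::real. \<bar>\<epsilon>\<bar> \<le> 2896 * (ln (real n) / sqrt (real n)) \<and>
         measure_pmf.prob (random_composition n)
             {xs. int (longest_run xs) < \<lfloor>log 2 (real n)\<rfloor> + h} =
           exp (- (omega n * 2 powi (- h - 2))) * (1 + \<epsilon>))"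
    using longest_run_distribution_uniform eventually_ge_at_top[of 1]
  proof eventually_elim
    case (elim n)
    show ?case
    proof (intro allI impI)
      fix h :: int
      let ?k = "\<lfloor>log 2 (real n)\<rfloor> + h"
      assume "- (1 / 4) * log 2 (real n) + frac (log 2 (real n)) \<le> real_of_int h \<and>
        real_of_int h \<le> log 2 (real n) + frac (log 2 (real n))"
      then have "3 / 4 * log 2 (real n) \<le> real_of_int ?k \<and> real_of_int ?k \<le> 2 * log 2 (real n)"
        by (simp add: frac_def)
      from elim(1)[rule_format, OF this]
      show "\<exists>\<epsilon>::real. \<bar>\<epsilon>\<bar> \<le> 2896 * (ln (real n) / sqrt (real n)) \<and>
         measure_pmf.prob (random_composition n) {xs. int (longest_run xs) < ?k} =
           exp (- (omega n * 2 powi (- h - 2))) * (1 + \<epsilon>)"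
        unfolding omega_rescaling[OF elim(2)] .
    qed
  qed
qed (rule longest_run_distribution_uniform)

end
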